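(* For every integer $n\ge2$, $B'(K_n)=\lfloor n^2/4\rfloor+\lceil n/2\rceil-2$.
   Context: $K_n$ is the complete graph on $n$ vertices. An edge-numbering of a graph $G$ is an assignment $f$ of distinct integers to the edges; $B'(f)$ is the maximum of $|f(e)-f(e')|$ over pairs of distinct incident edges $e,e'$. The edge-bandwidth $B'(G)$ is the minimum of $B'(f)$ over all edge-numberings $f$ of $G$. *)

theory Defs
  imports Complex_Main
begin

text \<open>A simple graph is given by its set of edges, each edge being a two-element set of vertices
  (isolated vertices do not affect the edge-bandwidth).\<close>

definition complete_graph_edges :: "'a set \<Rightarrow> 'a set set" where
  "complete_graph_edges V = {e. e \<subseteq> V \<and> card e = 2}"

definition edge_numbering :: "'a set set \<Rightarrow> ('a set \<Rightarrow> int) \<Rightarrow> bool" where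
  "edge_numbering E f \<longleftrightarrow> inj_on f E"

definition incident_edges :: "'a set \<Rightarrow> 'a set \<Rightarrow> bool" where
  "incident_edges e e' \<longleftrightarrow> e \<noteq> e' \<and> e \<inter> e' \<noteq> {}"

text \<open>The inserted 0 only fixes the maximum as 0 when no two distinct edges are incident
  (for instance when there is a single edge); otherwise it has no effect.\<close>

definition edge_numbering_bandwidth :: "'a set set \<Rightarrow> ('a set \<Rightarrow> int) \<Rightarrow> nat" where
  "edge_numbering_bandwidth E f =
     Max (insert 0 {nat \<bar>f e - f e'\<bar> | e e'. e \<in> E \<and> e' \<in> E \<and> incident_edges e e'})"

definition edge_bandwidth :: "'a set set \<Rightarrow> nat" where
  "edge_bandwidth E = (LEAST k. \<exists>f. edge_numbering E f \<and> edge_numbering_bandwidth E f = k)"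

end

theory Submission
  imports Defs
begin

text \<open>
  Write \<open>n = p + q\<close> with \<open>q \<le> p \<le> q + 1\<close>; the claimed value is \<open>p q + p - 2\<close>.

  Lower bound: more than \<open>C(a, 2)\<close> edges cover more than \<open>a\<close> vertices. Hence the \<open>C(p - 1, 2) + 1\<close>
  edges with the lowest numbers and the \<open>C(q, 2) + 1\<close> edges with the highest numbers cover at least
  \<open>p\<close> and \<open>q + 1\<close> vertices, so some low edge meets some high edge, and all the remaining
  edges are numbered between these two.

  Upper bound: split the vertices into \<open>x\<^sub>0, \<dots>, x\<^bsub>p-1\<^esub>\<close> and \<open>y\<^sub>0, \<dots>, y\<^bsub>q-1\<^esub>\<close>. Number
  consecutively: the edges inside \<open>X\<close>, ordered by their larger index; the edges \<open>x\<^sub>i y\<^sub>j\<close> with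
  \<open>j \<ge> i + 2\<close>, by decreasing \<open>j\<close>; the edges \<open>x\<^sub>i y\<^sub>j\<close> with \<open>|i - j| \<le> 1\<close>; the edges \<open>x\<^sub>i y\<^sub>j\<close> with
  \<open>i \<ge> j + 2\<close>, by increasing \<open>i\<close>; the edges inside \<open>Y\<close>, by decreasing larger index. Then \<open>x\<^sub>i\<close>
  sees no number below \<open>C(i, 2)\<close> and none above \<open>C(i, 2) + p q + p - 2\<close>, and similarly for \<open>y\<^sub>j\<close>.
\<close>

section \<open>The numbering\<close>

definition tri :: "nat \<Rightarrow> int" where
  "tri k = int (k choose 2)"

lemma tri_0 [simp]: "tri 0 = 0"
  by (simp add: tri_def)

lemma tri_Suc [simp]: "tri (Suc k) = tri k + int k"
  by (simp add: tri_def numeral_2_eq_2)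

lemma tri_nonneg: "0 \<le> tri k"
  by (simp add: tri_def)

lemma tri_mono: "i \<le> j \<Longrightarrow> tri i \<le> tri j"
  by (induction j rule: dec_induct) auto

lemma tri_less_lower: "i < j \<Longrightarrow> tri i + int i \<le> tri j"
  using tri_mono[of "Suc i" j] by simp

lemma tri_less_upper: "i < j \<Longrightarrow> tri i + int j - 1 \<le> tri j"
  using tri_mono[of i "j - 1"] by (cases j) auto

lemma tri_ge_pred: "int k - 1 \<le> tri k"
  using tri_less_upper[of 0 k] by (cases k) auto

lemma tri_add: "tri (p + q) = tri p + tri q + int p * int q"
  by (induction q) (auto simp: algebra_simps)

lemma tri_double: "2 * tri k = int k * int k - int k"
  by (induction k) (auto simp: algebra_simps)

text \<open>Both cases reduce to \<open>q * q = 2 * C(q, 2) + q\<close>. This is where the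
  near-equal sizes of the two parts enter.\<close>

lemma tri_balanced:
  assumes "p = q \<or> p = Suc q"
  shows "int p * int q = tri p + tri q + int q"
  using assms tri_double[of q] by (auto simp: algebra_simps)

section \<open>The five blocks of numbers\<close>

text \<open>The number of the edge \<open>{a, b}\<close>, \<open>a < b < p + q\<close>, where \<open>x\<^sub>i\<close> is \<open>i\<close> and \<open>y\<^sub>j\<close> is
  \<open>p + j\<close>. The constants come from the block sizes, simplified with
  \<open>p q = C(p, 2) + C(q, 2) + q\<close>, which holds for \<open>p \<in> {q, q + 1}\<close>.\<close>

definition pair_number :: "nat \<Rightarrow> nat \<Rightarrow> nat \<Rightarrow> nat \<Rightarrow> int" where
  "pair_number p q a b =
    (if b < p then tri b + int a
     else if p \<le> a then 2 * (int p * int q) - int q - 1 - tri (b - p) - int (a - p)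
     else if a + 2 \<le> b - p then int p * int q - 2 * int q + 1 - tri (b - p) + int a
     else if b - p \<le> a + 1 \<and> a \<le> b - p + 1
       then int p * int q - 2 * int q + 1 + int a + 2 * int (b - p)
     else int p * int q + int p + tri a + int (b - p) - int a)"

text \<open>The blocks occupy successive intervals with thresholds \<open>tri p\<close>,
  \<open>p q - 2 q + 1\<close>, \<open>p q + p - 1\<close> and \<open>tri p + p q\<close>. Each case
  carries its interval so that edges of different blocks can be told apart.\<close>

lemma pair_number_cases:
  assumes "p = q \<or> p = Suc q" "a < b" "b < p + q"
  obtains (X) "b < p" "pair_number p q a b = tri b + int a" "pair_number p q a b < tri p"
  | (Early) j where "b = p + j" "a < p" "j < q" "a + 2 \<le> j"
      "pair_number p q a b = int p * int q - 2 * int q + 1 - tri j + int a"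
      "tri p \<le> pair_number p q a b" "pair_number p q a b < int p * int q - 2 * int q + 1"
  | (Middle) j where "b = p + j" "a < p" "j < q" "j \<le> a + 1" "a \<le> j + 1"
      "pair_number p q a b = int p * int q - 2 * int q + 1 + int a + 2 * int j"
      "int p * int q - 2 * int q + 1 \<le> pair_number p q a b"
      "pair_number p q a b < int p * int q + int p - 1"
  | (Late) j where "b = p + j" "a < p" "j < q" "j + 2 \<le> a"
      "pair_number p q a b = int p * int q + int p + tri a + int j - int a"
      "int p * int q + int p - 1 \<le> pair_number p q a b"
      "pair_number p q a b < tri p + int p * int q"
  | (Y) i j where "a = p + i" "b = p + j" "i < j" "j < q"
      "pair_number p q a b = 2 * (int p * int q) - int q - 1 - tri j - int i"
      "tri p + int p * int q \<le> pair_number p q a b"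
proof -
  define M where "M = int p * int q"
  have M: "M = tri p + tri q + int q"
    using tri_balanced[OF assms(1)] by (simp add: M_def)
  consider "b < p" | "p \<le> a" | "a < p" "p \<le> b" by linarith
  then show thesis
  proof cases
    case 1
    show thesis
      by (rule X) (use 1 assms(2) tri_less_lower[of b p] in \<open>auto simp: pair_number_def\<close>)
  next
    case 2
    then obtain i j where ij: "a = p + i" "b = p + j"
      using assms(2) by (metis less_imp_le_nat le_trans nat_le_iff_add)
    then have lt: "i < j" "j < q" using assms by auto
    show thesis
      by (rule Y[OF ij lt]) (use ij lt M tri_less_lower[of j q] in
          \<open>auto simp: pair_number_def M_def[symmetric]\<close>)
  next
    case 3
    then obtain j where b: "b = p + j" by (metis nat_le_iff_add)
    then have j: "j < q" using assms by auto
    consider "a + 2 \<le> j" | "j \<le> a + 1" "a \<le> j + 1" | "j + 2 \<le> a" by linarith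
    then show thesis
    proof cases
      case 1
      have "pair_number p q a b = M - 2 * int q + 1 - tri j + int a"
        using 1 3 b by (auto simp: pair_number_def M_def)
      \<comment> \<open>This gives the upper end of the interval; the next inequality gives the
        lower end.\<close>
      moreover have "int a < tri j" using 1 tri_ge_pred[of j] by linarith
      moreover have "tri j + int q - 1 \<le> tri q" using tri_less_upper[OF j] .
      ultimately show thesis
        using Early[OF b 3(1) j 1] M unfolding M_def[symmetric] by linarith
    next
      case 2
      have "pair_number p q a b = M - 2 * int q + 1 + int a + 2 * int j"
        using 2 3 b by (auto simp: pair_number_def M_def)
      then show thesis
        using Middle[OF b 3(1) j 2] 3(1) j unfolding M_def[symmetric] by linarith
    next
      case c: 3
      have "pair_number p q a b = M + int p + tri a + int j - int a"
        using c 3 b by (auto simp: pair_number_def M_def)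
      then show thesis
        using Late[OF b 3(1) j c] c tri_ge_pred[of a] tri_less_upper[OF 3(1)]
        unfolding M_def[symmetric] by linarith
    qed
  qed
qed

text \<open>For fixed \<open>b\<close> the values fill \<open>tri b, ..., tri (b + 1) - 1\<close>,
  and these ranges are disjoint.\<close>

lemma tri_plus_inj:
  assumes "tri b + int a = tri b' + int a'" "a < b" "a' < b'"
  shows "a = a' \<and> b = b'"
proof -
  have False if "b < b'" using tri_less_lower[OF that] assms by linarith
  moreover have False if "b' < b" using tri_less_lower[OF that] assms by linarith
  ultimately have "b = b'" by (metis nat_neq_iff)
  then show ?thesis using assms(1) by simp
qed

text \<open>For fixed \<open>b\<close> the values run from \<open>tri (b - 1) + 1\<close> to
  \<open>tri b\<close>.\<close>

lemma tri_minus_inj: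
  assumes "tri b - int a = tri b' - int a'" "a + 2 \<le> b" "a' + 2 \<le> b'"
  shows "a = a' \<and> b = b'"
proof -
  have False if "b < b'" using tri_less_upper[OF that] assms by linarith
  moreover have False if "b' < b" using tri_less_upper[OF that] assms by linarith
  ultimately have "b = b'" by (metis nat_neq_iff)
  then show ?thesis using assms(1) by simp
qed

text \<open>For fixed \<open>b\<close> the values run from \<open>tri (b - 1) - 1\<close> to
  \<open>tri b - 2\<close>.\<close>

lemma tri_shift_inj:
  assumes "tri b + int a - int b = tri b' + int a' - int b'" "a + 2 \<le> b" "a' + 2 \<le> b'"
  shows "a = a' \<and> b = b'"
proof -
  have False if "b < b'" using tri_less_upper[OF that] assms by linarith
  moreover have False if "b' < b" using tri_less_upper[OF that] assms by linarith
  ultimately have "b = b'" by (metis nat_neq_iff)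
  then show ?thesis using assms(1) by simp
qed

section \<open>Injectivity of the numbering\<close>

lemma pair_number_inj:
  assumes pq: "p = q \<or> p = Suc q"
    and ab: "a < b" "b < p + q" and ab': "a' < b'" "b' < p + q"
    and eq: "pair_number p q a b = pair_number p q a' b'"
  shows "a = a' \<and> b = b'"
proof -
  define M where "M = int p * int q"
  have M: "M = tri p + tri q + int q"
    using tri_balanced[OF pq] by (simp add: M_def)
  have block_bounds: "tri p \<le> M - 2 * int q + 1" "M - 2 * int q + 1 \<le> M + int p - 1"
    "M + int p - 1 \<le> tri p + M"
    using M tri_ge_pred[of q] tri_ge_pred[of p] ab pq by auto
  note pair_number_cases' = pair_number_cases[OF pq, folded M_def,
    consumes 2, case_names X Early Middle Late Y]
  show ?thesis
    using ab
  proof (cases rule: pair_number_cases')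
    case X
    note c = this
    show ?thesis
      using ab'
    proof (cases rule: pair_number_cases')
      case X
      have "tri b + int a = tri b' + int a'" using c eq X by linarith
      then show ?thesis using tri_plus_inj ab(1) ab'(1) by blast
    qed (rule FalseE, use c eq block_bounds in linarith)+
  next
    case (Early j)
    note c = this
    show ?thesis
      using ab'
    proof (cases rule: pair_number_cases')
      case (Early j')
      have "tri j - int a = tri j' - int a'" using c eq Early by linarith
      then show ?thesis using tri_minus_inj c Early by blast
    qed (rule FalseE, use c eq block_bounds in linarith)+
  next
    case (Middle j)
    note c = this
    show ?thesis
      using ab'
    proof (cases rule: pair_number_cases')
      case (Middle j')
      have eq': "a + 2 * j = a' + 2 * j'" using c eq Middle by linarith
      \<comment> \<open>If \<open>j < j'\<close>, then \<open>a \<ge> a' + 2\<close>, whereas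
        \<open>a \<le> j + 1 \<le> j' \<le> a' + 1\<close>; the other case is symmetric.\<close>
      have "\<not> j < j'" "\<not> j' < j" using eq' c(4,5) Middle(4,5) by linarith+
      then have "j = j'" by linarith
      then show ?thesis using eq' c(1) Middle(1) by simp
    qed (rule FalseE, use c eq block_bounds in linarith)+
  next
    case (Late j)
    note c = this
    show ?thesis
      using ab'
    proof (cases rule: pair_number_cases')
      case (Late j')
      have "tri a + int j - int a = tri a' + int j' - int a'" using c eq Late by linarith
      then show ?thesis using tri_shift_inj c Late by blast
    qed (rule FalseE, use c eq block_bounds in linarith)+
  next
    case (Y i j)
    note c = this
    show ?thesis
      using ab'
    proof (cases rule: pair_number_cases')
      case (Y i' j')
      have "tri j + int i = tri j' + int i'" using c eq Y by linarith
      then show ?thesis using tri_plus_inj c Y by blast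
    qed (rule FalseE, use c eq block_bounds in linarith)+
  qed
qed

section \<open>The range of numbers at one vertex\<close>

definition lowest_number :: "nat \<Rightarrow> nat \<Rightarrow> nat \<Rightarrow> int" where
  "lowest_number p q v =
    (if v < p then tri v else int p * int q - int q + 1 - tri (v - p) - int p)"

text \<open>Two edges sharing \<open>v\<close> fall into one window, hence differ by at most
  \<open>p q + p - 2\<close>. For \<open>y_j\<close> the window is fixed from above: its upper end
  \<open>2 p q - q - 1 - C(j, 2)\<close> is the number of \<open>{y_0, y_j}\<close> when
  \<open>j \<ge> 1\<close>.\<close>

lemma pair_number_bounds:
  assumes pq: "p = q \<or> p = Suc q" and ab: "a < b" "b < p + q" and v: "v = a \<or> v = b"
  shows "lowest_number p q v \<le> pair_number p q a b \<and>
    pair_number p q a b \<le> lowest_number p q v + int p * int q + int p - 2"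
proof -
  define M where "M = int p * int q"
  have M: "M = tri p + tri q + int q"
    using tri_balanced[OF pq] by (simp add: M_def)
  have nonneg: "0 \<le> tri v" "0 \<le> tri p" "0 \<le> tri q" "int p - 1 \<le> tri p" "int q - 1 \<le> tri q"
    "1 \<le> p" "1 \<le> q" "tri q \<le> tri p" "tri p \<le> tri q + int q"
    using ab pq by (auto simp: tri_nonneg tri_ge_pred)
  note pair_number_cases' = pair_number_cases[OF pq, folded M_def,
    consumes 2, case_names X Early Middle Late Y]
  have "lowest_number p q v \<le> pair_number p q a b \<and>
    pair_number p q a b \<le> lowest_number p q v + M + int p - 2"
    using ab
  proof (cases rule: pair_number_cases')
    case X
    then show ?thesis
      using v ab M nonneg tri_less_lower[of a b] tri_nonneg[of a] tri_nonneg[of b]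
      by (auto simp: lowest_number_def)
  next
    case (Early j)
    then show ?thesis
      using v M nonneg tri_less_lower[of a p] tri_nonneg[of a] tri_less_upper[of j q] pq
      by (auto simp: lowest_number_def M_def[symmetric])
  next
    case (Middle j)
    then show ?thesis
      using v M nonneg tri_less_lower[of a p] tri_nonneg[of a] tri_less_upper[of j q]
        tri_nonneg[of j] pq
      by (auto simp: lowest_number_def M_def[symmetric])
  next
    case (Late j)
    then show ?thesis
      using v M nonneg tri_less_upper[of a p] tri_nonneg[of a] tri_less_upper[of j q]
        tri_nonneg[of j] pq
      by (auto simp: lowest_number_def M_def[symmetric])
  next
    case (Y i j)
    then show ?thesis
      using v M nonneg tri_less_lower[of i j] tri_nonneg[of i] tri_less_lower[of j q]
        tri_nonneg[of j] pq
      by (auto simp: lowest_number_def M_def[symmetric])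
  qed
  then show ?thesis by (simp only: M_def)
qed

section \<open>Upper bound\<close>

lemma finite_complete_graph_edges: "finite V \<Longrightarrow> finite (complete_graph_edges V)"
  by (simp add: complete_graph_edges_def)

lemma finite_incident_differences:
  assumes "finite E"
  shows "finite {nat \<bar>f e - f e'\<bar> | e e'. e \<in> E \<and> e' \<in> E \<and> incident_edges e e'}"
proof (rule finite_subset)
  show "{nat \<bar>f e - f e'\<bar> | e e'. e \<in> E \<and> e' \<in> E \<and> incident_edges e e'}
    \<subseteq> (\<lambda>(e, e'). nat \<bar>f e - f e'\<bar>) ` (E \<times> E)" by auto
qed (use assms in simp)

lemma edge_numbering_bandwidth_le:
  assumes "finite E"
    and "\<And>e e'. e \<in> E \<Longrightarrow> e' \<in> E \<Longrightarrow> incident_edges e e' \<Longrightarrow> \<bar>f e - f e'\<bar> \<le> int k"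
  shows "edge_numbering_bandwidth E f \<le> k"
  unfolding edge_numbering_bandwidth_def
  using assms finite_incident_differences[OF assms(1), of f] by (subst Max_le_iff) fastforce+

lemma edge_numbering_bandwidth_ge:
  assumes "finite E" "e \<in> E" "e' \<in> E" "incident_edges e e'"
  shows "\<bar>f e - f e'\<bar> \<le> int (edge_numbering_bandwidth E f)"
proof -
  have "nat \<bar>f e - f e'\<bar> \<le> edge_numbering_bandwidth E f"
    unfolding edge_numbering_bandwidth_def
    by (rule Max_ge) (use assms finite_incident_differences[OF assms(1), of f] in auto)
  then show ?thesis by linarith
qed

lemma complete_graph_numbering_exists:
  assumes V: "finite V" "card V = p + q" and pq: "p = q \<or> p = Suc q" and q: "1 \<le> q"
  obtains f where "edge_numbering (complete_graph_edges V) f"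
    "int (edge_numbering_bandwidth (complete_graph_edges V) f) \<le> int p * int q + int p - 2"
proof -
  obtain h where h: "bij_betw h V {0..<p + q}"
    using ex_bij_betw_finite_nat[OF V(1)] V(2) by auto
  \<comment> \<open>\<open>Min\<close> and \<open>Max\<close> sort the endpoints, as
    \<open>pair_number\<close> expects its smaller vertex first.\<close>
  define f where "f e = pair_number p q (Min (h ` e)) (Max (h ` e))" for e
  have image: "Min (h ` e) < Max (h ` e) \<and> Max (h ` e) < p + q \<and> h ` e = {Min (h ` e), Max (h ` e)}"
    if "e \<in> complete_graph_edges V" for e
  proof -
    have e: "e \<subseteq> V" "card e = 2" using that by (auto simp: complete_graph_edges_def)
    then have "card (h ` e) = 2"
      using h by (metis bij_betw_def card_image inj_on_subset)
    moreover have "h ` e \<subseteq> {0..<p + q}" using e h by (auto simp: bij_betw_def)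
    ultimately obtain a b where "h ` e = {a, b}" "a \<noteq> b" "a < p + q" "b < p + q"
      by (auto simp: card_2_iff)
    then show ?thesis by (auto simp: min_def max_def)
  qed
  have "edge_numbering (complete_graph_edges V) f"
    unfolding edge_numbering_def
  proof (rule inj_onI)
    fix e e' assume e: "e \<in> complete_graph_edges V" and e': "e' \<in> complete_graph_edges V"
      and "f e = f e'"
    then have "h ` e = h ` e'"
      using pair_number_inj[OF pq, of "Min (h ` e)" "Max (h ` e)" "Min (h ` e')" "Max (h ` e')"]
        image[OF e] image[OF e'] by (metis f_def)
    then show "e = e'"
      using e e' h by (auto simp: complete_graph_edges_def bij_betw_def inj_on_image_eq_iff)
  qed
  moreover have "edge_numbering_bandwidth (complete_graph_edges V) f \<le> nat (int p * int q + int p - 2)"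
  proof (rule edge_numbering_bandwidth_le[OF finite_complete_graph_edges[OF V(1)]])
    fix e e' assume e: "e \<in> complete_graph_edges V" and e': "e' \<in> complete_graph_edges V"
      and "incident_edges e e'"
    then obtain v where v: "v \<in> e" "v \<in> e'" by (auto simp: incident_edges_def)
    then have "h v = Min (h ` e) \<or> h v = Max (h ` e)" "h v = Min (h ` e') \<or> h v = Max (h ` e')"
      using image[OF e] image[OF e'] by blast+
    then show "\<bar>f e - f e'\<bar> \<le> int (nat (int p * int q + int p - 2))"
      using pair_number_bounds[OF pq, of "Min (h ` e)" "Max (h ` e)" "h v"]
        pair_number_bounds[OF pq, of "Min (h ` e')" "Max (h ` e')" "h v"]
        image[OF e] image[OF e'] unfolding f_def by linarith
  qed
  \<comment> \<open>The target is nonnegative, so \<open>nat\<close> does not truncate it.\<close>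
  moreover have "2 \<le> int p * int q + int p"
  proof -
    have "1 * 1 \<le> int p * int q" using pq q by (intro mult_mono) auto
    then show ?thesis using pq q by auto
  qed
  ultimately show thesis using that by (simp add: le_nat_iff)
qed

section \<open>Lower bound\<close>

text \<open>Repeatedly add the minimum of the remaining edges. Applied to \<open>- f\<close>, this
  also selects the highest edges.\<close>

lemma ex_lowest_subset:
  fixes f :: "'b \<Rightarrow> int"
  assumes "finite E" "inj_on f E" "k \<le> card E"
  shows "\<exists>I\<subseteq>E. card I = k \<and> (\<forall>e\<in>I. \<forall>e'\<in>E - I. f e < f e')"
  using assms(3)
proof (induction k)
  case 0
  then show ?case by (intro exI[of _ "{}"]) auto
next
  case (Suc k)
  then obtain I where I: "I \<subseteq> E" "card I = k" "\<forall>e\<in>I. \<forall>e'\<in>E - I. f e < f e'" by auto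
  have fin: "finite I" "finite (E - I)" using I assms(1) finite_subset by auto
  have "E \<noteq> I" using I(2) Suc.prems by auto
  then have "E - I \<noteq> {}" using I(1) by blast
  then obtain m where m: "m \<in> E - I" "\<forall>e\<in>E - I. f m \<le> f e"
    using fin(2) arg_min_if_finite[of "E - I" f] by (meson not_less)
  have "f m < f e" if "e \<in> E - insert m I" for e
  proof -
    have "f m \<noteq> f e" using m(1) that assms(2) by (auto dest: inj_onD)
    then show ?thesis using m(2) that by force
  qed
  then show ?case
    using I m fin by (intro exI[of _ "insert m I"]) auto
qed

text \<open>Every edge of \<open>I\<close> is a pair inside \<open>\<Union>I\<close>, so
  \<open>card I\<close> is at most \<open>C(card (\<Union>I), 2)\<close>.\<close>

lemma card_Union_complete_graph_edges:
  assumes "finite V" "I \<subseteq> complete_graph_edges V" "a choose 2 < card I"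
  shows "a < card (\<Union>I)"
proof (rule ccontr)
  assume "\<not> a < card (\<Union>I)"
  have fin: "finite (\<Union>I)"
    using assms by (auto simp: complete_graph_edges_def intro!: finite_subset[of "\<Union>I" V])
  have "card I \<le> card {e. e \<subseteq> \<Union>I \<and> card e = 2}"
    by (rule card_mono) (use fin assms(2) in \<open>auto simp: complete_graph_edges_def\<close>)
  also have "\<dots> = card (\<Union>I) choose 2" using n_subsets[OF fin] by simp
  also have "\<dots> \<le> a choose 2" using \<open>\<not> a < card (\<Union>I)\<close> by (intro binomial_right_mono) auto
  finally show False using assms(3) by simp
qed

text \<open>Valid for every such split of the vertex count; the bound equals
  \<open>Suc r * (q + 1) - 2\<close>, which the balanced split maximizes.\<close>

lemma complete_graph_bandwidth_ge:
  assumes V: "finite V" "card V = Suc r + q" and q: "1 \<le> q"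
    and f: "edge_numbering (complete_graph_edges V) f"
  shows "int (Suc r) * int q + int (Suc r) - 2
    \<le> int (edge_numbering_bandwidth (complete_graph_edges V) f)"
\<comment> \<open>The single edge of \<open>K_2\<close> cannot supply both a low and a high set, but
  there the bound is 0.\<close>
proof (cases "r = 0 \<and> q = 1")
  case False
  define E where "E = complete_graph_edges V"
  have fin: "finite E" using V by (simp add: E_def finite_complete_graph_edges)
  have inj: "inj_on f E" using f by (simp add: E_def edge_numbering_def)
  have "card E = card V choose 2"
    unfolding E_def complete_graph_edges_def by (rule n_subsets[OF V(1)])
  then have cardE: "int (card E) = tri (Suc r) + tri q + int (Suc r) * int q"
    using V(2) tri_add[of "Suc r" q] by (simp add: tri_def)
  have "2 \<le> r + q" using q False by linarith
  also have "\<dots> \<le> r + Suc r * q" by simp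
  finally have size: "2 \<le> int r + int (Suc r) * int q"
    by (metis of_nat_add of_nat_mult of_nat_mono of_nat_numeral)
  \<comment> \<open>Beyond \<open>C(r, 2) + C(q, 2)\<close> there are
    \<open>r + Suc r * q \<ge> 2\<close> edges, leaving room for disjoint \<open>I\<close> and
    \<open>F\<close>.\<close>
  have cards: "card E \<ge> Suc (r choose 2) + Suc (q choose 2)"
    using cardE[unfolded tri_Suc] size tri_def[of r] tri_def[of q] by linarith
  obtain I where I: "I \<subseteq> E" "card I = Suc (r choose 2)" "\<forall>e\<in>I. \<forall>e'\<in>E - I. f e < f e'"
    using ex_lowest_subset[OF fin inj, of "Suc (r choose 2)"] cards by auto
  have finI: "finite I" using finite_subset[OF I(1) fin] .
  have cardEI: "card (E - I) = card E - card I" using I finI by (simp add: card_Diff_subset)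
  have "inj_on (\<lambda>e. - f e) (E - I)" using inj by (auto simp: inj_on_def)
  moreover have "Suc (q choose 2) \<le> card (E - I)" using cards cardEI I(2) by linarith
  ultimately have "\<exists>F\<subseteq>E - I. card F = Suc (q choose 2) \<and>
      (\<forall>e\<in>F. \<forall>e'\<in>E - I - F. - f e < - f e')"
    using fin by (intro ex_lowest_subset) auto
  then obtain F where F: "F \<subseteq> E - I" "card F = Suc (q choose 2)"
    "\<forall>e\<in>F. \<forall>e'\<in>E - I - F. f e' < f e"
    by auto
  have "r < card (\<Union>I)" "q < card (\<Union>F)"
    using card_Union_complete_graph_edges[OF V(1), of I r]
      card_Union_complete_graph_edges[OF V(1), of F q] I F unfolding E_def by auto
  moreover have sub: "\<Union>I \<subseteq> V" "\<Union>F \<subseteq> V"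
    using I F by (auto simp: E_def complete_graph_edges_def)
  \<comment> \<open>Disjoint covers would need \<open>(r + 1) + (q + 1)\<close> vertices, one more
    than \<open>V\<close> has.\<close>
  ultimately have "\<Union>I \<inter> \<Union>F \<noteq> {}"
    using V card_Un_disjoint[of "\<Union>I" "\<Union>F"] card_mono[OF V(1), of "\<Union>I \<union> \<Union>F"]
      finite_subset[OF _ V(1)] by force
  then obtain e e' where e: "e \<in> I" and e': "e' \<in> F" and "e \<inter> e' \<noteq> {}" by blast
  then have inc: "incident_edges e e'" using F by (auto simp: incident_edges_def)
  have "f ` (E - I - F) \<subseteq> {f e<..<f e'}" using I F e e' by auto
  then have "card (E - I - F) \<le> card {f e<..<f e'}"
    using card_inj_on_le[of f "E - I - F"] inj inj_on_subset
    by (metis Diff_subset finite_greaterThanLessThan_int order_trans)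
  moreover have "card (E - I - F) = card E - card I - card F"
    using F cardEI fin finite_subset[OF F(1)] by (simp add: card_Diff_subset)
  moreover have "f e < f e'" using I F e e' by auto
  \<comment> \<open>The remaining edges have distinct numbers strictly between \<open>f e\<close>
    and \<open>f e'\<close>, hence the \<open>+ 1\<close>. As
    \<open>tri (Suc r) - tri r = r\<close>, the left side is the claimed bound.\<close>
  ultimately have "int (card E) - int (card I) - int (card F) + 1 \<le> \<bar>f e - f e'\<bar>"
    using cards I F by simp
  also have "\<dots> \<le> int (edge_numbering_bandwidth E f)"
    by (rule edge_numbering_bandwidth_ge[OF fin _ _ inc]) (use I F e e' in auto)
  finally show ?thesis
    using cardE I F unfolding E_def by (simp add: tri_def[symmetric])
qed simp

theorem theorem13:
  fixes V :: "'a set" and n :: nat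
  assumes "finite V" and "card V = n" and "n \<ge> 2"
  shows "int (edge_bandwidth (complete_graph_edges V)) =
    \<lfloor>(real n)\<^sup>2 / 4\<rfloor> + \<lceil>real n / 2\<rceil> - 2"
proof -
  define q where "q = n div 2"
  \<comment> \<open>\<open>Suc r\<close> is the larger part, so it is
    \<open>\<lceil>n / 2\<rceil>\<close>.\<close>
  define r where "r = n - q - 1"
  have n: "n = Suc r + q" and q: "1 \<le> q" and bal: "Suc r = q \<or> Suc r = Suc q"
    using assms(3) unfolding q_def r_def by linarith+
  have closed_form: "\<lfloor>(real n)\<^sup>2 / 4\<rfloor> = int (Suc r) * int q" "\<lceil>real n / 2\<rceil> = int (Suc r)"
    using bal unfolding n floor_eq_iff ceiling_eq_iff
    by (auto simp: power2_eq_square field_simps)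
  let ?E = "complete_graph_edges V"
  obtain f where f: "edge_numbering ?E f"
    "int (edge_numbering_bandwidth ?E f) \<le> int (Suc r) * int q + int (Suc r) - 2"
    using complete_graph_numbering_exists[OF assms(1) _ bal q] assms(2) n by blast
  have lower: "edge_numbering_bandwidth ?E f \<le> edge_numbering_bandwidth ?E g"
    if "edge_numbering ?E g" for g
    using complete_graph_bandwidth_ge[OF assms(1) _ q that] assms(2) n f(2) by fastforce
  have "edge_bandwidth ?E = edge_numbering_bandwidth ?E f"
    unfolding edge_bandwidth_def using f(1) lower by (intro Least_equality) auto
  moreover have "int (edge_numbering_bandwidth ?E f) = int (Suc r) * int q + int (Suc r) - 2"
    using complete_graph_bandwidth_ge[OF assms(1) _ q f(1)] assms(2) n f(2) by fastforce
  ultimately show ?thesis unfolding closed_form by simp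
qed

end
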